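(* Consider a multipartite quantum system with Hilbert space $\mathcal{H}=\mathcal{H}_1\otimes\cdots\otimes\mathcal{H}_n$ of finite dimension at least $2$. The largest possible scaled entanglement gap of a Hamiltonian on $\mathcal{H}$ is $g_E^{\max}=M^{\max}$, and it is achieved by any Hamiltonian of the form $H'=I-|\Psi_{\mathrm{me}}\rangle\langle\Psi_{\mathrm{me}}|$, where $|\Psi_{\mathrm{me}}\rangle$ is a maximally entangled state, i.e. a unit vector with $M(|\Psi_{\mathrm{me}}\rangle)=M^{\max}$.
   Context: A density operator on $\mathcal{H}$ is separable if it is a convex combination of pure product states; $\mathcal{S}$ is the set of separable states. For a Hermitian operator (Hamiltonian) $H$ on $\mathcal{H}$ that is not a multiple of the identity, let $E_0$ and $E_{\max}$ be its smallest and largest eigenvalues, $E_{\mathrm{tot}}=E_{\max}-E_0$, $E_{\mathrm{sep}}=\min_{\rho\in\mathcal{S}}\mathrm{tr}[H\rho]$, $G_E=E_{\mathrm{sep}}-E_0$ (entanglement gap), and $g_E=G_E/E_{\mathrm{tot}}$ (scaled entanglement gap). For a unit vector $|\Psi\rangle\in\mathcal{H}$, define $M(|\Psi\rangle)=1-\max_{\rho\in\mathcal{S}}\langle\Psi|\rho|\Psi\rangle$, and let $M^{\max}=\max_{|\Psi\rangle}M(|\Psi\rangle)$ over all unit vectors in $\mathcal{H}$. *)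

theory Defs
  imports "Jordan_Normal_Form.Spectral_Radius" "Jordan_Normal_Form.Schur_Decomposition"
begin

section \<open>States of a multipartite system\<close>

text \<open>
  The system is described by the list \<open>ds = [d_1, ..., d_n]\<close> of local dimensions.
  An orthonormal basis of every factor is fixed, so the i-th factor is \<open>carrier_vec (ds ! i)\<close>
  (complex column vectors) and the tensor product of all of them is
  \<open>carrier_vec (prod_list ds)\<close>, a product basis vector being numbered by the mixed-radix
  value of its local indices. The inner product is \<open>v \<bullet>c w\<close>, linear in \<open>v\<close>
  and conjugate-linear in \<open>w\<close>: it is \<open>\<langle>w|v\<rangle>\<close> in Dirac notation.
\<close>

definition tensor_vec :: "complex vec \<Rightarrow> complex vec \<Rightarrow> complex vec" where
  "tensor_vec v w =
     vec (dim_vec v * dim_vec w) (\<lambda>i. v $ (i div dim_vec w) * w $ (i mod dim_vec w))"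

definition tensor_vecs :: "complex vec list \<Rightarrow> complex vec" where
  "tensor_vecs vs = foldr tensor_vec vs (vec 1 (\<lambda>_. 1))"

definition unit_state :: "nat \<Rightarrow> complex vec \<Rightarrow> bool" where
  "unit_state d v \<longleftrightarrow> v \<in> carrier_vec d \<and> v \<bullet>c v = 1"

definition product_state :: "nat list \<Rightarrow> complex vec \<Rightarrow> bool" where
  "product_state ds v \<longleftrightarrow> (\<exists>vs. list_all2 unit_state ds vs \<and> v = tensor_vecs vs)"

text \<open>The operator \<open>|v\<rangle>\<langle>v|\<close>.\<close>

definition ket_bra :: "complex vec \<Rightarrow> complex mat" where
  "ket_bra v = mat (dim_vec v) (dim_vec v) (\<lambda>(i, j). v $ i * cnj (v $ j))"

definition mat_trace :: "complex mat \<Rightarrow> complex" where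
  "mat_trace A = (\<Sum>i<dim_row A. A $$ (i, i))"

definition hermitian :: "nat \<Rightarrow> complex mat \<Rightarrow> bool" where
  "hermitian d A \<longleftrightarrow> A \<in> carrier_mat d d \<and> mat_adjoint A = A"

text \<open>\<open>\<langle>v|A|v\<rangle>\<close>, which is a real number when \<open>A\<close> is Hermitian.\<close>

definition expval :: "complex mat \<Rightarrow> complex vec \<Rightarrow> real" where
  "expval A v = Re ((A *\<^sub>v v) \<bullet>c v)"

definition density_operator :: "nat \<Rightarrow> complex mat \<Rightarrow> bool" where
  "density_operator d \<rho> \<longleftrightarrow>
     hermitian d \<rho> \<and> (\<forall>v \<in> carrier_vec d. 0 \<le> expval \<rho> v) \<and> mat_trace \<rho> = 1"

text \<open>
  The type of matrices has no dimension-independent zero, so the convex combination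
  \<open>\<Sum>k<m. p k |v k\<rangle>\<langle>v k|\<close> is formed entrywise.
\<close>

definition separable_states :: "nat list \<Rightarrow> complex mat set" where
  "separable_states ds = {\<rho>. density_operator (prod_list ds) \<rho> \<and>
     (\<exists>(m::nat) (p :: nat \<Rightarrow> real) (v :: nat \<Rightarrow> complex vec).
        (\<forall>k<m. 0 \<le> p k) \<and> (\<Sum>k<m. p k) = 1 \<and> (\<forall>k<m. product_state ds (v k)) \<and>
        \<rho> = mat (prod_list ds) (prod_list ds)
              (\<lambda>(i, j). \<Sum>k<m. complex_of_real (p k) * ket_bra (v k) $$ (i, j)))}"

section \<open>Hamiltonians and the entanglement gap\<close>

definition hamiltonian :: "nat list \<Rightarrow> complex mat \<Rightarrow> bool" where
  "hamiltonian ds H \<longleftrightarrow>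
     hermitian (prod_list ds) H \<and> \<not> (\<exists>c. H = c \<cdot>\<^sub>m 1\<^sub>m (prod_list ds))"

text \<open>
  All eigenvalues of a Hermitian matrix are real, so the set below is its whole spectrum.
\<close>

definition real_spectrum :: "complex mat \<Rightarrow> real set" where
  "real_spectrum H = {e. eigenvalue H (complex_of_real e)}"

definition E_0 :: "complex mat \<Rightarrow> real" where
  "E_0 H = Min (real_spectrum H)"

definition E_max :: "complex mat \<Rightarrow> real" where
  "E_max H = Max (real_spectrum H)"

definition E_tot :: "complex mat \<Rightarrow> real" where
  "E_tot H = E_max H - E_0 H"

text \<open>
  \<open>LEAST\<close> and \<open>GREATEST\<close> on the reals denote a minimum and a maximum, not an infimum and
  a supremum: they are unspecified if the extremum is not attained.
  The trace of a product of two Hermitian matrices is real.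
\<close>

definition E_sep :: "nat list \<Rightarrow> complex mat \<Rightarrow> real" where
  "E_sep ds H = (LEAST e. \<exists>\<rho> \<in> separable_states ds. e = Re (mat_trace (H * \<rho>)))"

definition G_E :: "nat list \<Rightarrow> complex mat \<Rightarrow> real" where
  "G_E ds H = E_sep ds H - E_0 H"

definition g_E :: "nat list \<Rightarrow> complex mat \<Rightarrow> real" where
  "g_E ds H = G_E ds H / E_tot H"

definition g_E_max :: "nat list \<Rightarrow> real" where
  "g_E_max ds = (GREATEST g. \<exists>H. hamiltonian ds H \<and> g = g_E ds H)"

section \<open>Geometric entanglement\<close>

definition M_ent :: "nat list \<Rightarrow> complex vec \<Rightarrow> real" where
  "M_ent ds \<Psi> = 1 - (GREATEST x. \<exists>\<rho> \<in> separable_states ds. x = expval \<rho> \<Psi>)"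

definition M_max :: "nat list \<Rightarrow> real" where
  "M_max ds = (GREATEST m. \<exists>\<Psi>. unit_state (prod_list ds) \<Psi> \<and> m = M_ent ds \<Psi>)"

definition maximally_entangled :: "nat list \<Rightarrow> complex vec \<Rightarrow> bool" where
  "maximally_entangled ds \<Psi> \<longleftrightarrow> unit_state (prod_list ds) \<Psi> \<and> M_ent ds \<Psi> = M_max ds"

end

(* Tr(H rho) over separable rho is a convex combination of expectations in product states,
   so E_sep(H) and max <Psi|rho|Psi> are extrema over the sequentially compact set of product
   vectors. If psi_0 is a ground state of H, then
     <v|H|v> <= E_max - E_tot |<psi_0|v>|^2
   for all unit vectors v. Taking for v the product vector closest to psi_0 gives
   G_E(H) <= E_tot M(psi_0), i.e. g_E(H) <= M(psi_0) <= M_max. For H' = I - |Psi><Psi| the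
   eigenvalues are 0 and 1 and E_sep(H') = M(Psi), so g_E(H') = M(Psi).
   The extremal eigenvalues are obtained variationally: a vector on which a positive
   semidefinite form vanishes is in its kernel, so no diagonalisation is needed. *)
theory Submission
  imports Defs
begin

text \<open>Extrema written with \<open>LEAST\<close> and \<open>GREATEST\<close> are unspecified
  unless attained, so \<open>E_sep\<close>, \<open>M_ent\<close>, \<open>M_max\<close> and
  \<open>g_E_max\<close> each need an actual optimiser and not only a bound; hence the weight given
  to compactness. The bound on <v|H|v> comes from splitting v along psi_0: the orthogonal part
  carries weight 1 - |<psi_0|v>|^2 and energy at most E_max per unit of weight, and the cross terms
  vanish because psi_0 is an eigenvector. It is an equality for all v exactly when every unit vector
  orthogonal to psi_0 has energy E_max, that is when H is I - |psi_0><psi_0| up to a shift and a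
  nonnegative factor. This is the origin of H'.\<close>

lemma sum_div_mod_mult:
  fixes f g :: "nat \<Rightarrow> 'a::comm_semiring_0"
  shows "(\<Sum>i<m * n. f (i div n) * g (i mod n)) = (\<Sum>i<m. f i) * (\<Sum>j<n. g j)"
proof -
  let ?h = "\<lambda>i. f (i div n) * g (i mod n)"
  \<comment> \<open>The range is cut into \<open>m\<close> blocks of length \<open>n\<close>, on
    each of which \<open>i div n\<close> is constant and \<open>i mod n\<close> runs through all
    residues.\<close>
  have "sum ?h {..<m * n} = (\<Sum>i<m. sum ?h {i * n..<i * n + n})"
    by (rule sum.nat_group[symmetric])
  also have "\<dots> = (\<Sum>i<m. \<Sum>j<n. f i * g j)"
  proof (rule sum.cong[OF refl])
    fix i
    have "sum ?h {0 + i * n..<n + i * n} = (\<Sum>j = 0..<n. ?h (j + i * n))"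
      by (rule sum.shift_bounds_nat_ivl)
    also have "\<dots> = (\<Sum>j<n. f i * g j)"
      by (rule sum.cong) auto
    finally show "sum ?h {i * n..<i * n + n} = (\<Sum>j<n. f i * g j)"
      by (simp add: add.commute)
  qed
  finally show ?thesis by (simp add: sum_product)
qed

subsection \<open>Coordinate form of inner products and expectations\<close>

lemma cscalar_prod_sum:
  fixes x y :: "complex vec"
  assumes "y \<in> carrier_vec d"
  shows "x \<bullet>c y = (\<Sum>i<d. x $ i * cnj (y $ i))"
  using assms by (auto simp: scalar_prod_def atLeast0LessThan)

lemma cscalar_prod_self:
  assumes "x \<in> carrier_vec d"
  shows "x \<bullet>c x = complex_of_real (\<Sum>i<d. (cmod (x $ i))\<^sup>2)"
  unfolding cscalar_prod_sum[OF assms] of_real_sum complex_norm_square ..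

lemma unit_state_iff:
  "unit_state d x \<longleftrightarrow> x \<in> carrier_vec d \<and> (\<Sum>i<d. (cmod (x $ i))\<^sup>2) = 1"
  unfolding unit_state_def by (auto simp: cscalar_prod_self simp flip: of_real_sum of_real_power)

lemma unit_state_carrier: "unit_state d x \<Longrightarrow> x \<in> carrier_vec d"
  by (simp add: unit_state_def)

lemma unit_state_entry_le:
  assumes "unit_state d x" "i < d"
  shows "cmod (x $ i) \<le> 1"
proof -
  have "(cmod (x $ i))\<^sup>2 \<le> (\<Sum>i<d. (cmod (x $ i))\<^sup>2)"
    by (rule member_le_sum) (use assms in auto)
  then have "(cmod (x $ i))\<^sup>2 \<le> 1"
    using assms by (simp add: unit_state_iff)
  then show ?thesis
    by (simp add: power2_le_iff_abs_le abs_square_le_1)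
qed

lemma unit_state_unit_vec: "i < d \<Longrightarrow> unit_state d (unit_vec d i)"
  by (simp add: unit_state_def)

lemma expval_sum:
  assumes "A \<in> carrier_mat d d" "x \<in> carrier_vec d"
  shows "expval A x = Re (\<Sum>i<d. (\<Sum>j<d. A $$ (i, j) * x $ j) * cnj (x $ i))"
proof -
  have "(A *\<^sub>v x) $ i = (\<Sum>j<d. A $$ (i, j) * x $ j)" if "i < d" for i
    using assms that by (auto simp: scalar_prod_def atLeast0LessThan)
  then show ?thesis
    unfolding expval_def cscalar_prod_sum[OF assms(2)] by (intro arg_cong[of _ _ Re] sum.cong) auto
qed

lemma ket_bra_carrier [simp]: "v \<in> carrier_vec d \<Longrightarrow> ket_bra v \<in> carrier_mat d d"
  by (auto simp: ket_bra_def)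

lemma ket_bra_mult_vec:
  assumes "v \<in> carrier_vec d" "x \<in> carrier_vec d"
  shows "ket_bra v *\<^sub>v x = (x \<bullet>c v) \<cdot>\<^sub>v v"
proof (rule eq_vecI)
  fix i assume "i < dim_vec ((x \<bullet>c v) \<cdot>\<^sub>v v)"
  then show "(ket_bra v *\<^sub>v x) $ i = ((x \<bullet>c v) \<cdot>\<^sub>v v) $ i"
    using assms by (auto simp: ket_bra_def scalar_prod_def sum_distrib_right sum_distrib_left ac_simps
        intro!: sum.cong)
qed (use assms in \<open>auto simp: ket_bra_def\<close>)

lemma cscalar_prod_commute:
  fixes x y :: "complex vec"
  assumes "x \<in> carrier_vec d" "y \<in> carrier_vec d"
  shows "x \<bullet>c y = cnj (y \<bullet>c x)"
  by (simp add: cscalar_prod_sum[OF assms(1)] cscalar_prod_sum[OF assms(2)] mult.commute)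

lemma expval_ket_bra:
  assumes "v \<in> carrier_vec d" "x \<in> carrier_vec d"
  shows "expval (ket_bra v) x = (cmod (x \<bullet>c v))\<^sup>2"
proof -
  have "((x \<bullet>c v) \<cdot>\<^sub>v v) \<bullet>c x = (x \<bullet>c v) * cnj (x \<bullet>c v)"
    using assms by (simp add: cscalar_prod_commute[of v d x])
  then show ?thesis
    by (simp add: expval_def ket_bra_mult_vec[OF assms] complex_norm_square[symmetric]
      del: complex_cnj_mult flip: of_real_power)
qed

text \<open>Both sides are the squared modulus of one overlap. The exchange lets either vector be
  the one that varies: product vectors against a fixed state, or states against a fixed product
  vector.\<close>

lemma expval_ket_bra_commute:
  assumes "v \<in> carrier_vec d" "x \<in> carrier_vec d"
  shows "expval (ket_bra v) x = expval (ket_bra x) v"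
  using assms by (simp add: expval_ket_bra cscalar_prod_commute[of v d x])

lemma mat_adjoint_eq: "mat_adjoint A = mat (dim_col A) (dim_row A) (\<lambda>(i, j). cnj (A $$ (j, i)))"
proof (rule eq_matI)
  fix i j assume "i < dim_row (mat (dim_col A) (dim_row A) (\<lambda>(i, j). cnj (A $$ (j, i))))"
    "j < dim_col (mat (dim_col A) (dim_row A) (\<lambda>(i, j). cnj (A $$ (j, i))))"
  then have "i < dim_col A" "j < dim_row A" by simp_all
  then show "mat_adjoint A $$ (i, j) = mat (dim_col A) (dim_row A) (\<lambda>(i, j). cnj (A $$ (j, i))) $$ (i, j)"
    unfolding mat_adjoint_def mat_of_rows_def by simp
qed (simp_all add: mat_adjoint_def)

lemma hermitian_iff:
  "hermitian d A \<longleftrightarrow> A \<in> carrier_mat d d \<and> (\<forall>i<d. \<forall>j<d. cnj (A $$ (j, i)) = A $$ (i, j))"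
proof (cases "A \<in> carrier_mat d d")
  case True
  then have dim: "dim_row A = d" "dim_col A = d" by simp_all
  have "mat_adjoint A = A \<longleftrightarrow> (\<forall>i<d. \<forall>j<d. cnj (A $$ (j, i)) = A $$ (i, j))"
    by (auto simp: mat_adjoint_eq mat_eq_iff[of _ A] dim)
  then show ?thesis
    using True by (simp only: hermitian_def simp_thms)
qed (simp add: hermitian_def)

lemma hermitian_cscalar_prod:
  assumes "hermitian d A" "x \<in> carrier_vec d" "y \<in> carrier_vec d"
  shows "(A *\<^sub>v x) \<bullet>c y = x \<bullet>c (A *\<^sub>v y)"
proof -
  have A: "A \<in> carrier_mat d d" and h: "\<And>i j. i < d \<Longrightarrow> j < d \<Longrightarrow> cnj (A $$ (j, i)) = A $$ (i, j)"
    using assms(1) by (simp_all add: hermitian_iff)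
  have ent: "(A *\<^sub>v z) $ i = (\<Sum>j<d. A $$ (i, j) * z $ j)" if "i < d" "z \<in> carrier_vec d" for z i
    using A that by (auto simp: scalar_prod_def atLeast0LessThan)
  have "(A *\<^sub>v x) \<bullet>c y = (\<Sum>i<d. \<Sum>j<d. A $$ (i, j) * x $ j * cnj (y $ i))"
    unfolding cscalar_prod_sum[OF assms(3)]
    by (intro sum.cong refl) (simp add: ent[OF _ assms(2)] sum_distrib_right)
  also have "\<dots> = (\<Sum>j<d. \<Sum>i<d. A $$ (i, j) * x $ j * cnj (y $ i))"
    by (rule sum.swap)
  also have "\<dots> = (\<Sum>j<d. x $ j * cnj ((A *\<^sub>v y) $ j))"
    by (intro sum.cong refl) (simp add: ent[OF _ assms(3)] sum_distrib_left h mult_ac)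
  also have "\<dots> = x \<bullet>c (A *\<^sub>v y)"
    by (rule cscalar_prod_sum[symmetric]) (use A assms in auto)
  finally show ?thesis .
qed

subsection \<open>Sequential compactness of unit vectors and product states\<close>

text \<open>Vectors of all dimensions share one type, so the convergence of C^d is expressed
  coordinatewise with \<open>d\<close> given explicitly; the dimensions of the members are tracked
  by separate carrier assumptions.\<close>

definition vlim :: "nat \<Rightarrow> (nat \<Rightarrow> complex vec) \<Rightarrow> complex vec \<Rightarrow> bool" where
  "vlim d X x \<longleftrightarrow> (\<forall>i<d. (\<lambda>n. X n $ i) \<longlonglongrightarrow> x $ i)"

lemma vlim_subseq: "vlim d X x \<Longrightarrow> strict_mono r \<Longrightarrow> vlim d (\<lambda>n. X (r n)) x"
  unfolding vlim_def using LIMSEQ_subseq_LIMSEQ[unfolded o_def] by blast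

text \<open>Bolzano-Weierstrass: a bounded monotone subsequence for the real part, then a further
  one for the imaginary part.\<close>

lemma complex_bounded_convergent_subseq:
  fixes f :: "nat \<Rightarrow> complex"
  assumes "\<And>n. cmod (f n) \<le> B"
  shows "\<exists>r l. strict_mono r \<and> (\<lambda>n. f (r n)) \<longlonglongrightarrow> l"
proof -
  have real: "\<exists>r l. strict_mono (r :: nat \<Rightarrow> nat) \<and> (\<lambda>n. g (r n)) \<longlonglongrightarrow> l"
    if "\<And>n. \<bar>g n\<bar> \<le> B" for g :: "nat \<Rightarrow> real"
  proof -
    obtain r where r: "strict_mono r" "monoseq (\<lambda>n. g (r n))"
      using seq_monosub[of g] by auto
    have "Bseq (\<lambda>n. g (r n))"
      by (rule BseqI'[of _ B]) (use that in auto)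
    from Bseq_monoseq_convergent[OF this r(2)] r(1) show ?thesis
      unfolding convergent_def by blast
  qed
  obtain r a where r: "strict_mono r" "(\<lambda>n. Re (f (r n))) \<longlonglongrightarrow> a"
    using real[of "\<lambda>n. Re (f n)"] order_trans[OF abs_Re_le_cmod assms] by blast
  obtain s b where s: "strict_mono s" "(\<lambda>n. Im (f (r (s n)))) \<longlonglongrightarrow> b"
    using real[of "\<lambda>n. Im (f (r n))"] order_trans[OF abs_Im_le_cmod assms] by blast
  have "(\<lambda>n. Complex (Re (f (r (s n)))) (Im (f (r (s n))))) \<longlonglongrightarrow> Complex a b"
    by (intro tendsto_Complex s) (use LIMSEQ_subseq_LIMSEQ[OF r(2) s(1)] in \<open>simp add: o_def\<close>)
  moreover have "strict_mono (\<lambda>n. r (s n))"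
    using r(1) s(1) by (simp add: strict_mono_def)
  ultimately show ?thesis
    by (intro exI[of _ "\<lambda>n. r (s n)"] exI[of _ "Complex a b"]) simp
qed

lemma bounded_vlim_subseq:
  fixes X :: "nat \<Rightarrow> complex vec"
  assumes "\<And>n i. i < d \<Longrightarrow> cmod (X n $ i) \<le> B"
  shows "\<exists>r x. strict_mono r \<and> x \<in> carrier_vec d \<and> vlim d (\<lambda>n. X (r n)) x"
proof -
  \<comment> \<open>Induction on the number \<open>k\<close> of coordinates already made to
    converge; a further subsequence keeps the earlier limits.\<close>
  have "\<exists>r y. strict_mono r \<and> (\<forall>i<k. (\<lambda>n. X (r n) $ i) \<longlonglongrightarrow> y i)" if "k \<le> d" for k
    using that
  proof (induction k)
    case 0
    show ?case by (auto intro!: exI[of _ "\<lambda>n. n"] simp: strict_mono_def)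
  next
    case (Suc k)
    then obtain r y where r: "strict_mono r" "\<forall>i<k. (\<lambda>n. X (r n) $ i) \<longlonglongrightarrow> y i"
      by auto
    obtain s l where s: "strict_mono s" "(\<lambda>n. X (r (s n)) $ k) \<longlonglongrightarrow> l"
      using complex_bounded_convergent_subseq[of "\<lambda>n. X (r n) $ k" B] assms Suc.prems by auto
    have "(\<lambda>n. X (r (s n)) $ i) \<longlonglongrightarrow> y i" if "i < k" for i
      using LIMSEQ_subseq_LIMSEQ[OF _ s(1)] r(2) that by (fastforce simp: o_def)
    with s(2) have "\<forall>i<Suc k. (\<lambda>n. X (r (s n)) $ i) \<longlonglongrightarrow> (y(k := l)) i"
      by (auto simp: less_Suc_eq)
    moreover have "strict_mono (\<lambda>n. r (s n))"
      using r(1) s(1) by (simp add: strict_mono_def)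
    ultimately show ?case
      by (intro exI[of _ "\<lambda>n. r (s n)"] exI[of _ "y(k := l)"]) simp
  qed
  from this[of d] obtain r y where "strict_mono r" "\<forall>i<d. (\<lambda>n. X (r n) $ i) \<longlonglongrightarrow> y i"
    by auto
  then show ?thesis
    by (intro exI[of _ r] exI[of _ "vec d y"]) (auto simp: vlim_def)
qed

lemma unit_state_vlim_subseq:
  fixes X :: "nat \<Rightarrow> complex vec"
  assumes "\<forall>n. unit_state d (X n)"
  shows "\<exists>r x. strict_mono r \<and> unit_state d x \<and> vlim d (\<lambda>n. X (r n)) x"
proof -
  obtain r x where r: "strict_mono r" "x \<in> carrier_vec d" "vlim d (\<lambda>n. X (r n)) x"
    using bounded_vlim_subseq[of d X 1] unit_state_entry_le assms by blast
  have "(\<lambda>n. \<Sum>i<d. (cmod (X (r n) $ i))\<^sup>2) \<longlonglongrightarrow> (\<Sum>i<d. (cmod (x $ i))\<^sup>2)"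
    using r(3) by (intro tendsto_intros) (auto simp: vlim_def)
  moreover have "(\<Sum>i<d. (cmod (X n $ i))\<^sup>2) = 1" for n
    using assms by (simp add: unit_state_iff)
  ultimately have "unit_state d x"
    using r(2) by (simp add: unit_state_iff LIMSEQ_const_iff)
  with r show ?thesis by blast
qed

section \<open>Product vectors: recursion over the factors, normalisation, compactness\<close>

lemma product_state_Nil: "product_state [] v \<longleftrightarrow> v = vec 1 (\<lambda>_. 1)"
  by (simp add: product_state_def tensor_vecs_def)

lemma product_state_Cons:
  "product_state (d # ds) v \<longleftrightarrow>
    (\<exists>a b. unit_state d a \<and> product_state ds b \<and> v = tensor_vec a b)"
  unfolding product_state_def list_all2_Cons1
  by (metis foldr.simps(2) comp_apply tensor_vecs_def)

lemma unit_state_tensor_vec: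
  assumes "unit_state m a" "unit_state n b"
  shows "unit_state (m * n) (tensor_vec a b)"
proof -
  have dim: "dim_vec a = m" "dim_vec b = n"
    using assms by (auto simp: unit_state_def)
  have "(\<Sum>i<m * n. (cmod (tensor_vec a b $ i))\<^sup>2)
      = (\<Sum>i<m * n. (cmod (a $ (i div n)))\<^sup>2 * (cmod (b $ (i mod n)))\<^sup>2)"
    by (intro sum.cong) (auto simp: tensor_vec_def dim norm_mult power_mult_distrib)
  also have "\<dots> = 1"
    using assms sum_div_mod_mult[of "\<lambda>i. (cmod (a $ i))\<^sup>2" n "\<lambda>j. (cmod (b $ j))\<^sup>2" m]
    by (simp add: unit_state_iff)
  finally show ?thesis
    by (simp add: unit_state_iff tensor_vec_def dim)
qed

lemma vlim_tensor_vec: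
  assumes "\<And>n. X n \<in> carrier_vec k" "\<And>n. Y n \<in> carrier_vec l" "x \<in> carrier_vec k" "y \<in> carrier_vec l"
    and "vlim k X x" "vlim l Y y"
  shows "vlim (k * l) (\<lambda>n. tensor_vec (X n) (Y n)) (tensor_vec x y)"
  unfolding vlim_def
proof (intro allI impI)
  fix i assume i: "i < k * l"
  \<comment> \<open>\<open>i < k * l\<close> excludes \<open>l = 0\<close>, for which
    \<open>i mod l < l\<close> would fail.\<close>
  then have "i div l < k" "i mod l < l"
    by (cases l; simp add: less_mult_imp_div_less)+
  then have "(\<lambda>n. X n $ (i div l) * Y n $ (i mod l)) \<longlonglongrightarrow> x $ (i div l) * y $ (i mod l)"
    using assms(5,6) by (intro tendsto_mult) (auto simp: vlim_def)
  then show "(\<lambda>n. tensor_vec (X n) (Y n) $ i) \<longlonglongrightarrow> tensor_vec x y $ i"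
    using i carrier_vecD[OF assms(1)] carrier_vecD[OF assms(2)] carrier_vecD[OF assms(3)]
      carrier_vecD[OF assms(4)]
    by (simp add: tensor_vec_def)
qed

lemma product_state_unit_state: "product_state ds v \<Longrightarrow> unit_state (prod_list ds) v"
proof (induction ds arbitrary: v)
  case Nil
  then show ?case by (simp add: product_state_Nil unit_state_iff)
next
  case (Cons d ds)
  then show ?case by (auto simp: product_state_Cons intro: unit_state_tensor_vec)
qed

lemma product_state_exists: "prod_list ds \<noteq> 0 \<Longrightarrow> \<exists>v. product_state ds v"
proof (induction ds)
  case Nil
  then show ?case by (simp add: product_state_Nil)
next
  case (Cons d ds)
  then obtain b where "product_state ds b" by auto
  moreover have "unit_state d (unit_vec d 0)"
    using Cons.prems by (intro unit_state_unit_vec) simp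
  ultimately show ?case by (auto simp: product_state_Cons)
qed

text \<open>Each factor is normalised separately, hence bounded, so a convergent subsequence can be
  chosen for the first factor and refined for the remaining ones; continuity of the tensor product
  carries the limits over.\<close>

lemma product_state_vlim_subseq:
  fixes X :: "nat \<Rightarrow> complex vec"
  assumes "\<forall>n. product_state ds (X n)"
  shows "\<exists>r x. strict_mono r \<and> product_state ds x \<and> vlim (prod_list ds) (\<lambda>n. X (r n)) x"
  using assms
proof (induction ds arbitrary: X)
  case Nil
  then have "X n = vec 1 (\<lambda>_. 1)" for n by (simp add: product_state_Nil)
  then show ?case
    by (auto simp: product_state_Nil vlim_def intro!: exI[of _ "\<lambda>n. n"] strict_monoI)
next
  case (Cons d ds)
  have "\<forall>n. \<exists>a b. unit_state d a \<and> product_state ds b \<and> X n = tensor_vec a b"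
    using Cons.prems by (simp add: product_state_Cons)
  then obtain A B where AB: "\<And>n. unit_state d (A n)" "\<And>n. product_state ds (B n)"
    "\<And>n. X n = tensor_vec (A n) (B n)" by metis
  obtain r a where r: "strict_mono r" "unit_state d a" "vlim d (\<lambda>n. A (r n)) a"
    using unit_state_vlim_subseq[of d A] AB(1) by blast
  obtain s b where s: "strict_mono s" "product_state ds b" "vlim (prod_list ds) (\<lambda>n. B (r (s n))) b"
    using Cons.IH[of "\<lambda>n. B (r n)"] AB(2) by blast
  have "vlim (d * prod_list ds) (\<lambda>n. tensor_vec (A (r (s n))) (B (r (s n)))) (tensor_vec a b)"
    by (rule vlim_tensor_vec)
      (use AB r s in \<open>auto intro: vlim_subseq[OF r(3) s(1)] unit_state_carrier product_state_unit_state\<close>)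
  moreover have "strict_mono (\<lambda>n. r (s n))"
    using r(1) s(1) by (simp add: strict_mono_def)
  ultimately show ?case
    using r(2) s(2)
    by (intro exI[of _ "\<lambda>n. r (s n)"] exI[of _ "tensor_vec a b"]) (auto simp: product_state_Cons AB(3))
qed

section \<open>Attained minima\<close>

text \<open>The assumption \<open>lsc\<close> bundles compactness of \<open>S\<close> with lower
  semicontinuity of \<open>F\<close>: it asks only for a point no worse than the limit value. This
  weak form fits expectations, which are continuous, as well as \<open>- M_ent ds\<close>.\<close>

lemma lsc_attains_min:
  fixes F :: "'a \<Rightarrow> real"
  assumes "S \<noteq> {}" and lower: "\<And>x. x \<in> S \<Longrightarrow> L \<le> F x"
    and lsc: "\<And>X c. (\<And>n::nat. X n \<in> S) \<Longrightarrow> (\<lambda>n. F (X n)) \<longlonglongrightarrow> c \<Longrightarrow> \<exists>x\<in>S. F x \<le> c"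
  shows "\<exists>x\<in>S. \<forall>y\<in>S. F x \<le> F y"
proof -
  define c where "c = Inf (F ` S)"
  have bdd: "bdd_below (F ` S)"
    using lower by (auto intro!: bdd_belowI)
  have le: "c \<le> F y" if "y \<in> S" for y
    unfolding c_def by (rule cInf_lower) (use that bdd in auto)
  have "\<exists>x\<in>S. F x < c + inverse (real (Suc n))" for n
    using cInf_lessD[of "F ` S" "c + inverse (real (Suc n))"] assms(1) by (auto simp: c_def)
  then obtain X where X: "\<And>n. X n \<in> S" "\<And>n. F (X n) < c + inverse (real (Suc n))"
    by metis
  have "(\<lambda>n. F (X n)) \<longlonglongrightarrow> c"
  proof (rule tendsto_sandwich[of "\<lambda>_. c" _ _ "\<lambda>n. c + inverse (real (Suc n))"])
    show "(\<lambda>n. c + inverse (real (Suc n))) \<longlonglongrightarrow> c"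
      using tendsto_add[OF tendsto_const[of c] LIMSEQ_inverse_real_of_nat] by simp
  qed (use X le in \<open>auto intro!: always_eventually less_imp_le simp del: of_nat_Suc\<close>)
  from lsc[OF X(1) this] le show ?thesis by force
qed

lemma tendsto_expval:
  assumes "A \<in> carrier_mat d d" "\<And>n. X n \<in> carrier_vec d" "x \<in> carrier_vec d" "vlim d X x"
  shows "(\<lambda>n. expval A (X n)) \<longlonglongrightarrow> expval A x"
  unfolding expval_sum[OF assms(1,2)] expval_sum[OF assms(1,3)]
  using assms(4) by (intro tendsto_intros) (auto simp: vlim_def)

text \<open>A crude bound, enough to make the infimum over unit vectors finite: coordinates of a
  unit vector have modulus at most 1.\<close>

lemma expval_lower_bound:
  assumes "A \<in> carrier_mat d d" "unit_state d x"
  shows "- (\<Sum>i<d. \<Sum>j<d. cmod (A $$ (i, j))) \<le> expval A x"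
proof -
  let ?z = "\<Sum>i<d. (\<Sum>j<d. A $$ (i, j) * x $ j) * cnj (x $ i)"
  have "cmod ?z \<le> (\<Sum>i<d. \<Sum>j<d. cmod (A $$ (i, j)))"
  proof (intro order_trans[OF norm_sum] sum_mono)
    fix i assume "i \<in> {..<d}"
    then have "cmod ((\<Sum>j<d. A $$ (i, j) * x $ j) * cnj (x $ i)) \<le> cmod (\<Sum>j<d. A $$ (i, j) * x $ j)"
      using unit_state_entry_le[OF assms(2), of i] by (simp add: norm_mult mult_left_le)
    also have "\<dots> \<le> (\<Sum>j<d. cmod (A $$ (i, j)))"
      using unit_state_entry_le[OF assms(2)]
      by (intro order_trans[OF norm_sum] sum_mono) (simp add: norm_mult mult_left_le)
    finally show "cmod ((\<Sum>j<d. A $$ (i, j) * x $ j) * cnj (x $ i)) \<le> (\<Sum>j<d. cmod (A $$ (i, j)))" .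
  qed
  moreover have "- cmod ?z \<le> Re ?z"
    using abs_Re_le_cmod[of ?z] by linarith
  ultimately show ?thesis
    using expval_sum[OF assms(1) unit_state_carrier[OF assms(2)]] by linarith
qed

text \<open>\<open>S\<close> stays abstract to serve both the whole unit sphere, for extremal
  eigenvalues, and the product vectors, for separable energies.\<close>

lemma expval_attains_min:
  assumes A: "A \<in> carrier_mat d d" and ne: "S \<noteq> {}" and unit: "\<And>x. x \<in> S \<Longrightarrow> unit_state d x"
    and comp: "\<And>X :: nat \<Rightarrow> complex vec. \<forall>n. X n \<in> S \<Longrightarrow> \<exists>r x. strict_mono r \<and> x \<in> S \<and> vlim d (\<lambda>n. X (r n)) x"
  shows "\<exists>x\<in>S. \<forall>y\<in>S. expval A x \<le> expval A y"
proof (rule lsc_attains_min[OF ne])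
  fix X :: "nat \<Rightarrow> complex vec" and c assume X: "\<And>n. X n \<in> S" and c: "(\<lambda>n. expval A (X n)) \<longlonglongrightarrow> c"
  obtain r x where r: "strict_mono r" "x \<in> S" "vlim d (\<lambda>n. X (r n)) x"
    using comp[of X] X by blast
  have "(\<lambda>n. expval A (X (r n))) \<longlonglongrightarrow> expval A x"
    using r X unit unit_state_carrier by (intro tendsto_expval[OF A]) blast+
  moreover have "(\<lambda>n. expval A (X (r n))) \<longlonglongrightarrow> c"
    using LIMSEQ_subseq_LIMSEQ[OF c r(1)] by (simp add: o_def)
  ultimately have "expval A x = c"
    by (rule LIMSEQ_unique)
  with r(2) show "\<exists>x\<in>S. expval A x \<le> c" by auto
qed (use expval_lower_bound[OF A unit] in auto)

lemma unit_state_expval_min: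
  assumes "A \<in> carrier_mat d d" "d \<noteq> 0"
  obtains x where "unit_state d x" "\<And>y. unit_state d y \<Longrightarrow> expval A x \<le> expval A y"
proof -
  have "\<exists>x\<in>Collect (unit_state d). \<forall>y\<in>Collect (unit_state d). expval A x \<le> expval A y"
    by (rule expval_attains_min[OF assms(1)])
      (use unit_state_vlim_subseq unit_state_unit_vec[of 0 d] assms(2) in auto)
  with that show ?thesis by auto
qed

lemma product_state_expval_min:
  assumes "A \<in> carrier_mat (prod_list ds) (prod_list ds)" "prod_list ds \<noteq> 0"
  obtains x where "product_state ds x" "\<And>y. product_state ds y \<Longrightarrow> expval A x \<le> expval A y"
proof -
  have "\<exists>x\<in>Collect (product_state ds). \<forall>y\<in>Collect (product_state ds). expval A x \<le> expval A y"
    by (rule expval_attains_min[OF assms(1)])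
      (use product_state_vlim_subseq product_state_exists[OF assms(2)] product_state_unit_state in auto)
  with that show ?thesis by auto
qed

subsection \<open>Quadratic forms\<close>

lemma cscalar_prod_self_eq_0: "x \<in> carrier_vec d \<Longrightarrow> Re (x \<bullet>c x) = 0 \<Longrightarrow> x = 0\<^sub>v d"
  using conjugate_square_eq_0_vec[of x d] by (simp add: cscalar_prod_self)

lemma cscalar_prod_self_nonneg: "x \<in> carrier_vec d \<Longrightarrow> 0 \<le> Re (x \<bullet>c x)"
  by (simp add: cscalar_prod_self sum_nonneg)

lemma expval_add:
  assumes "hermitian d A" "x \<in> carrier_vec d" "y \<in> carrier_vec d"
  shows "expval A (x + y) = expval A x + expval A y + 2 * Re ((A *\<^sub>v x) \<bullet>c y)"
proof -
  have A: "A \<in> carrier_mat d d"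
    using assms(1) by (simp add: hermitian_def)
  note c = mult_mat_vec_carrier[OF A] assms(2,3) carrier_vec_conjugate
  \<comment> \<open>Hermiticity makes the two cross terms conjugate, so together they give twice a
    real part.\<close>
  have "(A *\<^sub>v y) \<bullet>c x = cnj ((A *\<^sub>v x) \<bullet>c y)"
    using hermitian_cscalar_prod[OF assms(1,3,2)] cscalar_prod_commute[of y d "A *\<^sub>v x"] c by simp
  moreover have "(A *\<^sub>v (x + y)) \<bullet>c (x + y)
      = (A *\<^sub>v x) \<bullet>c x + (A *\<^sub>v y) \<bullet>c x + ((A *\<^sub>v x) \<bullet>c y + (A *\<^sub>v y) \<bullet>c y)"
    using c by (simp add: mult_add_distrib_mat_vec[OF A] conjugate_add_vec[of _ d]
        scalar_prod_add_distrib[of _ d] add_scalar_prod_distrib[of _ d])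
  ultimately show ?thesis
    by (simp add: expval_def)
qed

lemma expval_smult_vec:
  assumes "A \<in> carrier_mat d d" "x \<in> carrier_vec d"
  shows "expval A (c \<cdot>\<^sub>v x) = (cmod c)\<^sup>2 * expval A x"
proof -
  have "(A *\<^sub>v (c \<cdot>\<^sub>v x)) \<bullet>c (c \<cdot>\<^sub>v x) = (c * cnj c) * ((A *\<^sub>v x) \<bullet>c x)"
    using assms mult_mat_vec_carrier[OF assms]
    by (simp add: mult_mat_vec[OF assms] conjugate_smult_vec mult.assoc)
  also have "\<dots> = complex_of_real ((cmod c)\<^sup>2) * ((A *\<^sub>v x) \<bullet>c x)"
    by (simp only: complex_norm_square)
  finally show ?thesis
    by (simp add: expval_def del: of_real_power)
qed

lemma expval_minus:
  assumes "A \<in> carrier_mat d d" "B \<in> carrier_mat d d" "x \<in> carrier_vec d"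
  shows "expval (A - B) x = expval A x - expval B x"
  unfolding expval_def minus_mult_distrib_mat_vec[OF assms]
  using mult_mat_vec_carrier[OF assms(1,3)] mult_mat_vec_carrier[OF assms(2,3)] assms(3)
  by (simp add: minus_scalar_prod_distrib[of _ d])

lemma expval_uminus:
  assumes "A \<in> carrier_mat d d" "x \<in> carrier_vec d"
  shows "expval (- A) x = - expval A x"
  using assms mult_mat_vec_carrier[OF assms] by (simp add: expval_def)

lemma smult_one_mult_vec:
  fixes x :: "'a::comm_semiring_1 vec"
  assumes "x \<in> carrier_vec d"
  shows "(c \<cdot>\<^sub>m 1\<^sub>m d) *\<^sub>v x = c \<cdot>\<^sub>v x"
  by (rule eq_vecI) (use assms in simp_all)

lemma expval_smult_one:
  assumes "x \<in> carrier_vec d"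
  shows "expval (c \<cdot>\<^sub>m 1\<^sub>m d) x = Re c * Re (x \<bullet>c x)"
proof -
  have "Im (x \<bullet>c x) = 0"
    by (simp add: cscalar_prod_self[OF assms])
  then show ?thesis
    using assms by (simp add: expval_def smult_one_mult_vec)
qed

lemma expval_one: "x \<in> carrier_vec d \<Longrightarrow> expval (1\<^sub>m d) x = Re (x \<bullet>c x)"
  by (simp add: expval_def)

lemma hermitian_one: "hermitian d (1\<^sub>m d)"
  by (simp add: hermitian_iff)

lemma hermitian_smult_one: "hermitian d (complex_of_real c \<cdot>\<^sub>m 1\<^sub>m d)"
  by (simp add: hermitian_iff)

lemma hermitian_minus: "hermitian d A \<Longrightarrow> hermitian d B \<Longrightarrow> hermitian d (A - B)"
  by (auto simp: hermitian_iff)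

lemma hermitian_uminus: "hermitian d A \<Longrightarrow> hermitian d (- A)"
  by (auto simp: hermitian_iff)

lemma hermitian_ket_bra: "v \<in> carrier_vec d \<Longrightarrow> hermitian d (ket_bra v)"
  by (auto simp: hermitian_iff ket_bra_def)

text \<open>A quadratic form scales with the squared norm, so a bound on the sphere extends to all
  vectors. The kernel argument and the orthogonal components involve vectors that are not
  normalised.\<close>

lemma expval_homogeneous_bound:
  assumes A: "A \<in> carrier_mat d d" and bound: "\<And>x. unit_state d x \<Longrightarrow> e \<le> expval A x"
    and y: "y \<in> carrier_vec d"
  shows "e * Re (y \<bullet>c y) \<le> expval A y"
proof (cases "Re (y \<bullet>c y) = 0")
  case True
  then have "y = 0\<^sub>v d"
    by (rule cscalar_prod_self_eq_0[OF y])
  then have "expval A y = 0"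
    using A mult_mat_vec_carrier[OF A y] by (simp add: expval_def)
  with True show ?thesis by simp
next
  case False
  define r where "r = Re (y \<bullet>c y)"
  define c where "c = complex_of_real (1 / sqrt r)"
  have r: "0 < r"
    using False cscalar_prod_self_nonneg[OF y] by (simp add: r_def)
  have c: "(cmod c)\<^sup>2 = 1 / r"
    using r by (simp add: c_def power_divide norm_divide)
  have "unit_state d (c \<cdot>\<^sub>v y)"
  proof -
    have "(\<Sum>i<d. (cmod ((c \<cdot>\<^sub>v y) $ i))\<^sup>2) = (cmod c)\<^sup>2 * (\<Sum>i<d. (cmod (y $ i))\<^sup>2)"
      using y by (simp add: norm_mult power_mult_distrib sum_distrib_left)
    also have "(\<Sum>i<d. (cmod (y $ i))\<^sup>2) = r"
      by (simp add: r_def cscalar_prod_self[OF y])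
    finally show ?thesis
      using r y by (simp add: unit_state_iff c)
  qed
  from bound[OF this] show ?thesis
    using r unfolding expval_smult_vec[OF A y] c r_def[symmetric] by (simp add: field_simps)
qed

text \<open>Moving from \<open>u\<close> to \<open>u + t y\<close> with
  \<open>y = A *\<^sub>v u\<close> changes the form by \<open>t\<^sup>2 * Q + 2 * t * N\<close>,
  where \<open>N\<close> is the squared norm of \<open>y\<close>. Unless \<open>N = 0\<close>, the
  linear term wins for small negative \<open>t\<close> and makes the form negative.\<close>

lemma psd_kernel:
  assumes A: "hermitian d A" and psd: "\<And>x. x \<in> carrier_vec d \<Longrightarrow> 0 \<le> expval A x"
    and u: "u \<in> carrier_vec d" "expval A u = 0"
  shows "A *\<^sub>v u = 0\<^sub>v d"
proof -
  have Ac: "A \<in> carrier_mat d d"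
    using A by (simp add: hermitian_def)
  define y where "y = A *\<^sub>v u"
  define N where "N = Re (y \<bullet>c y)"
  define Q where "Q = expval A y"
  have y: "y \<in> carrier_vec d"
    unfolding y_def using Ac u(1) by simp
  have N: "0 \<le> N" and Q: "0 \<le> Q"
    unfolding N_def Q_def using cscalar_prod_self_nonneg[OF y] psd[OF y] by simp_all
  \<comment> \<open>nearly the minimiser of \<open>t\<^sup>2 * Q + 2 * t * N\<close>; the \<open>+ 1\<close> covers \<open>Q = 0\<close>\<close>
  define t where "t = - N / (Q + 1)"
  have "0 \<le> expval A (u + complex_of_real t \<cdot>\<^sub>v y)"
    using psd u(1) y by simp
  also have "\<dots> = t\<^sup>2 * Q + 2 * (t * N)"
    using expval_add[OF A u(1), of "complex_of_real t \<cdot>\<^sub>v y"] y u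
    by (simp add: expval_smult_vec[OF Ac y] conjugate_smult_vec y_def[symmetric] N_def Q_def)
  \<comment> \<open>The factor \<open>(Q + 1)\<^sup>2\<close> clears the denominator of
    \<open>t\<close>.\<close>
  finally have "0 \<le> (t\<^sup>2 * Q + 2 * (t * N)) * (Q + 1)\<^sup>2"
    by simp
  also have "\<dots> = (t * (Q + 1))\<^sup>2 * Q + 2 * (t * (Q + 1)) * N * (Q + 1)"
    by (simp add: algebra_simps power2_eq_square)
  also have "t * (Q + 1) = - N"
    using Q by (simp add: t_def)
  also have "(- N)\<^sup>2 * Q + 2 * (- N) * N * (Q + 1) = - (N\<^sup>2 * (Q + 2))"
    by (simp add: algebra_simps power2_eq_square)
  finally have "N\<^sup>2 * (Q + 2) \<le> 0" by simp
  then have "N = 0"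
    using Q by (simp add: mult_le_0_iff)
  then show ?thesis
    using cscalar_prod_self_eq_0[OF y] by (simp add: N_def y_def)
qed

text \<open>The projection of \<open>y\<close> on \<open>u\<close> is removed, and Pythagoras gives
  the length of the rest. This yields the energy bound, Cauchy-Schwarz for unit vectors, and a
  nonzero vector orthogonal to a given one.\<close>

lemma orthogonal_decomposition:
  assumes u: "unit_state d u" and y: "unit_state d y"
  obtains w where "w \<in> carrier_vec d" "u \<bullet>c w = 0" "y = (y \<bullet>c u) \<cdot>\<^sub>v u + w"
    "Re (w \<bullet>c w) = 1 - (cmod (y \<bullet>c u))\<^sup>2"
proof -
  note uc = unit_state_carrier[OF u] and yc = unit_state_carrier[OF y]
  define c where "c = y \<bullet>c u"
  define w where "w = y - c \<cdot>\<^sub>v u"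
  have w: "w \<in> carrier_vec d"
    using uc yc by (simp add: w_def)
  have eq: "y = c \<cdot>\<^sub>v u + w"
    using uc yc by (auto simp: w_def)
  have "w \<bullet>c u = 0"
    using uc yc u by (simp add: w_def minus_scalar_prod_distrib[of _ d] unit_state_def c_def)
  then have ortho: "u \<bullet>c w = 0"
    using cscalar_prod_commute[OF uc w] by simp
  \<comment> \<open>Pythagoras, read as the expectation of the identity: its cross term is a
    multiple of the inner product just shown to vanish.\<close>
  have "expval (1\<^sub>m d) y = (cmod c)\<^sup>2 + Re (w \<bullet>c w)"
    using expval_add[OF hermitian_one, of "c \<cdot>\<^sub>v u" d w] uc w u ortho
    by (simp add: eq[symmetric] expval_smult_vec[of _ d] expval_one unit_state_def)
  then have norm: "Re (w \<bullet>c w) = 1 - (cmod c)\<^sup>2"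
    using y yc by (simp add: expval_one unit_state_def)
  show ?thesis
    by (rule that[OF w ortho eq[unfolded c_def] norm[unfolded c_def]])
qed

subsection \<open>Extremal eigenvalues\<close>

text \<open>\<open>Min\<close> and \<open>Max\<close> in \<open>E_0\<close> and \<open>E_max\<close>
  give genuine extrema only on finite nonempty sets.\<close>

lemma finite_real_spectrum:
  assumes "A \<in> carrier_mat d d"
  shows "finite (real_spectrum A)"
proof -
  have "real_spectrum A = complex_of_real -` spectrum A"
    by (auto simp: real_spectrum_def spectrum_def)
  then show ?thesis
    using card_finite_spectrum(1)[OF assms] by (simp add: finite_vimageI inj_of_real)
qed

lemma E_0_variational:
  assumes A: "hermitian d A" and d: "d \<noteq> 0"
  obtains u where "unit_state d u" "A *\<^sub>v u = complex_of_real (E_0 A) \<cdot>\<^sub>v u"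
    "expval A u = E_0 A" "E_0 A \<in> real_spectrum A"
    "\<And>y. y \<in> carrier_vec d \<Longrightarrow> E_0 A * Re (y \<bullet>c y) \<le> expval A y"
proof -
  have Ac: "A \<in> carrier_mat d d"
    using A by (simp add: hermitian_def)
  obtain u where u: "unit_state d u" and min: "\<And>y. unit_state d y \<Longrightarrow> expval A u \<le> expval A y"
    using unit_state_expval_min[OF Ac d] by blast
  note uc = unit_state_carrier[OF u]
  define e where "e = expval A u"
  \<comment> \<open>The shift makes the form nonnegative with value 0 at the minimiser
    \<open>u\<close>; that \<open>u\<close> lies in the kernel of \<open>B\<close> is the eigenvalue
    equation for \<open>A\<close>.\<close>
  define B where "B = A - complex_of_real e \<cdot>\<^sub>m 1\<^sub>m d"
  have bound: "e * Re (y \<bullet>c y) \<le> expval A y" if "y \<in> carrier_vec d" for y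
    unfolding e_def by (rule expval_homogeneous_bound[OF Ac min that])
  have B: "expval B y = expval A y - e * Re (y \<bullet>c y)" if "y \<in> carrier_vec d" for y
    unfolding B_def using that by (simp add: expval_minus[OF Ac] expval_smult_one)
  have "B *\<^sub>v u = 0\<^sub>v d"
    by (rule psd_kernel)
      (use bound B uc u A in \<open>auto simp: B_def hermitian_minus hermitian_smult_one e_def unit_state_def\<close>)
  then have diff: "A *\<^sub>v u - complex_of_real e \<cdot>\<^sub>v u = 0\<^sub>v d"
    using uc Ac by (simp add: B_def minus_mult_distrib_mat_vec[OF Ac] smult_one_mult_vec)
  have eig: "A *\<^sub>v u = complex_of_real e \<cdot>\<^sub>v u"
  proof (rule eq_vecI)
    fix i assume "i < dim_vec (complex_of_real e \<cdot>\<^sub>v u)"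
    then show "(A *\<^sub>v u) $ i = (complex_of_real e \<cdot>\<^sub>v u) $ i"
      using arg_cong[OF diff, of "\<lambda>v. v $ i"] uc Ac by simp
  qed (use uc Ac in auto)
  have "u \<noteq> 0\<^sub>v d"
    using u by (auto simp: unit_state_def)
  then have mem: "e \<in> real_spectrum A"
    using eig uc Ac by (auto simp: real_spectrum_def eigenvalue_def eigenvector_def)
  \<comment> \<open>No eigenvalue lies below \<open>e\<close>: on an eigenvector the form equals the
    eigenvalue times the squared norm.\<close>
  have E0: "E_0 A = e"
    unfolding E_0_def
  proof (rule Min_eqI[OF finite_real_spectrum[OF Ac] _ mem])
    fix f assume "f \<in> real_spectrum A"
    then obtain v where v: "v \<in> carrier_vec d" "v \<noteq> 0\<^sub>v d" "A *\<^sub>v v = complex_of_real f \<cdot>\<^sub>v v"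
      using Ac by (auto simp: real_spectrum_def eigenvalue_def eigenvector_def)
    have "expval A v = f * Re (v \<bullet>c v)"
      using v by (simp add: expval_def)
    moreover have "0 < Re (v \<bullet>c v)"
      using cscalar_prod_self_eq_0[OF v(1)] v(2) cscalar_prod_self_nonneg[OF v(1)] by fastforce
    ultimately show "e \<le> f"
      using bound[OF v(1)] by simp
  qed
  show ?thesis
    by (rule that[OF u]) (use eig mem bound in \<open>simp_all only: E0 e_def[symmetric]\<close>)
qed

text \<open>Negation keeps the eigenvectors and reflects the spectrum, so the largest eigenvalue
  needs no variational argument of its own.\<close>

lemma E_max_eq:
  assumes A: "hermitian d A" and d: "d \<noteq> 0"
  shows "E_max A = - E_0 (- A)"
proof -
  have Ac: "A \<in> carrier_mat d d"
    using A by (simp add: hermitian_def)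
  have "eigenvalue (- A) (complex_of_real (- e)) \<longleftrightarrow> eigenvalue A (complex_of_real e)" for e
  proof -
    have "eigenvector (- A) v (complex_of_real (- e)) \<longleftrightarrow> eigenvector A v (complex_of_real e)" for v
    proof -
      have "- (A *\<^sub>v v) = complex_of_real (- e) \<cdot>\<^sub>v v \<longleftrightarrow> A *\<^sub>v v = complex_of_real e \<cdot>\<^sub>v v"
        by (auto simp: vec_eq_iff)
      then show ?thesis
        using Ac by (auto simp: eigenvector_def)
    qed
    then show ?thesis by (simp add: eigenvalue_def)
  qed
  then have neg: "- e \<in> real_spectrum (- A) \<longleftrightarrow> e \<in> real_spectrum A" for e
    by (simp add: real_spectrum_def)
  have "real_spectrum (- A) = uminus ` real_spectrum A"
  proof safe
    fix e assume "e \<in> real_spectrum (- A)"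
    then show "e \<in> uminus ` real_spectrum A"
      using neg[of "- e"] by (intro image_eqI[of _ _ "- e"]) simp_all
  qed (simp add: neg)
  moreover have "real_spectrum A \<noteq> {}"
    using E_0_variational[OF A d] by blast
  ultimately show ?thesis
    unfolding E_max_def E_0_def using minus_Max_eq_Min[OF finite_real_spectrum[OF Ac]] by force
qed

lemma E_max_variational:
  assumes A: "hermitian d A" and d: "d \<noteq> 0"
  obtains u where "unit_state d u" "expval A u = E_max A"
    "\<And>y. y \<in> carrier_vec d \<Longrightarrow> expval A y \<le> E_max A * Re (y \<bullet>c y)"
proof -
  have Ac: "A \<in> carrier_mat d d"
    using A by (simp add: hermitian_def)
  obtain u where u: "unit_state d u" "expval (- A) u = E_0 (- A)"
    "\<And>y. y \<in> carrier_vec d \<Longrightarrow> E_0 (- A) * Re (y \<bullet>c y) \<le> expval (- A) y"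
    using E_0_variational[OF hermitian_uminus[OF A] d] by metis
  show ?thesis
  proof (rule that[OF u(1)])
    show "expval A u = E_max A"
      using u(2) by (simp add: E_max_eq[OF A d] expval_uminus[OF Ac unit_state_carrier[OF u(1)]])
    show "expval A y \<le> E_max A * Re (y \<bullet>c y)" if "y \<in> carrier_vec d" for y
      using u(3)[OF that] by (simp add: E_max_eq[OF A d] expval_uminus[OF Ac that])
  qed
qed

lemma expval_le_ground_overlap:
  assumes A: "hermitian d A" and d: "d \<noteq> 0" and u: "unit_state d u"
    and eig: "A *\<^sub>v u = complex_of_real (E_0 A) \<cdot>\<^sub>v u" and y: "unit_state d y"
  shows "expval A y \<le> E_max A - E_tot A * expval (ket_bra u) y"
proof -
  note uc = unit_state_carrier[OF u] and yc = unit_state_carrier[OF y]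
  have Ac: "A \<in> carrier_mat d d"
    using A by (simp add: hermitian_def)
  define c where "c = y \<bullet>c u"
  obtain w where w: "w \<in> carrier_vec d" "u \<bullet>c w = 0" "y = c \<cdot>\<^sub>v u + w"
    "Re (w \<bullet>c w) = 1 - (cmod c)\<^sup>2"
    unfolding c_def by (rule orthogonal_decomposition[OF u y])
  have "expval A u = E_0 A"
    using u uc by (simp add: expval_def eig unit_state_def)
  \<comment> \<open>The eigenvector equation keeps the image of \<open>c \<cdot>\<^sub>v u\<close>
    on the line of \<open>u\<close>, hence orthogonal to \<open>w\<close>.\<close>
  moreover have "(A *\<^sub>v (c \<cdot>\<^sub>v u)) \<bullet>c w = 0"
    using uc w by (simp add: mult_mat_vec[OF Ac uc] eig)
  ultimately have "expval A y = (cmod c)\<^sup>2 * E_0 A + expval A w"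
    unfolding w(3) using expval_add[OF A, of "c \<cdot>\<^sub>v u" w] uc w(1)
    by (simp add: expval_smult_vec[OF Ac uc])
  moreover have "expval A w \<le> E_max A * Re (w \<bullet>c w)"
    using E_max_variational[OF A d] w(1) by metis
  moreover have "expval (ket_bra u) y = (cmod c)\<^sup>2"
    unfolding c_def by (rule expval_ket_bra[OF uc yc])
  ultimately show ?thesis
    by (simp add: w(4) E_tot_def algebra_simps)
qed

subsection \<open>Separable states\<close>

lemma mat_trace_mult:
  assumes "A \<in> carrier_mat d d" "B \<in> carrier_mat d d"
  shows "mat_trace (A * B) = (\<Sum>i<d. \<Sum>j<d. A $$ (i, j) * B $$ (j, i))"
  using assms by (auto simp: mat_trace_def scalar_prod_def atLeast0LessThan intro!: sum.cong)

lemma mat_trace_mult_ket_bra: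
  assumes "A \<in> carrier_mat d d" "v \<in> carrier_vec d"
  shows "Re (mat_trace (A * ket_bra v)) = expval A v"
  unfolding expval_sum[OF assms] mat_trace_mult[OF assms(1) ket_bra_carrier[OF assms(2)]]
  using assms(2) by (intro arg_cong[of _ _ Re] sum.cong refl) (simp add: ket_bra_def sum_distrib_right mult.assoc)

text \<open>With <x|\<rho>|x> written as a trace against \<rho>, the convex decomposition used for
  energies also serves \<open>M_ent\<close>.\<close>

lemma expval_eq_mat_trace:
  assumes "\<rho> \<in> carrier_mat d d" "x \<in> carrier_vec d"
  shows "expval \<rho> x = Re (mat_trace (ket_bra x * \<rho>))"
proof -
  have "(\<Sum>i<d. (\<Sum>j<d. \<rho> $$ (i, j) * x $ j) * cnj (x $ i))
      = (\<Sum>i<d. \<Sum>j<d. ket_bra x $$ (j, i) * \<rho> $$ (i, j))"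
    using assms(2) by (intro sum.cong refl) (simp add: ket_bra_def sum_distrib_right sum_distrib_left mult_ac)
  also have "\<dots> = mat_trace (ket_bra x * \<rho>)"
    unfolding mat_trace_mult[OF ket_bra_carrier[OF assms(2)] assms(1)] by (rule sum.swap)
  finally show ?thesis
    using expval_sum[OF assms] by simp
qed

lemma separable_states_carrier:
  "\<rho> \<in> separable_states ds \<Longrightarrow> \<rho> \<in> carrier_mat (prod_list ds) (prod_list ds)"
  by (simp add: separable_states_def density_operator_def hermitian_def)

text \<open>The trace is linear in \<rho>, so a separable state yields a weighted average of values
  at product vectors and cannot lie beyond the extreme ones.\<close>

lemma separable_mat_trace:
  assumes A: "A \<in> carrier_mat (prod_list ds) (prod_list ds)" and \<rho>: "\<rho> \<in> separable_states ds"
  obtains m p v where "\<forall>k<m. 0 \<le> (p k :: real)" "(\<Sum>k<(m::nat). p k) = 1"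
    "\<forall>k<m. product_state ds (v k)"
    "Re (mat_trace (A * \<rho>)) = (\<Sum>k<m. p k * expval A (v k))"
proof -
  define d where "d = prod_list ds"
  obtain m and p :: "nat \<Rightarrow> real" and v where pv: "\<And>k. k < m \<Longrightarrow> 0 \<le> p k" "(\<Sum>k<m. p k) = 1"
    "\<And>k. k < m \<Longrightarrow> product_state ds (v k)"
    and eq: "\<rho> = mat d d (\<lambda>(i, j). \<Sum>k<m. complex_of_real (p k) * ket_bra (v k) $$ (i, j))"
    using \<rho> unfolding separable_states_def d_def by blast
  have v: "v k \<in> carrier_vec d" if "k < m" for k
    using pv(3)[OF that] by (simp add: product_state_unit_state unit_state_carrier d_def)
  have A': "A \<in> carrier_mat d d" using A by (simp add: d_def)
  have "mat_trace (A * \<rho>)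
      = (\<Sum>i<d. \<Sum>j<d. \<Sum>k<m. complex_of_real (p k) * (A $$ (i, j) * ket_bra (v k) $$ (j, i)))"
    unfolding mat_trace_mult[OF A' separable_states_carrier[OF \<rho>, folded d_def]]
    by (intro sum.cong refl) (simp add: eq sum_distrib_left mult_ac)
  also have "\<dots> = (\<Sum>i<d. \<Sum>k<m. \<Sum>j<d. complex_of_real (p k) * (A $$ (i, j) * ket_bra (v k) $$ (j, i)))"
    by (intro sum.cong refl sum.swap)
  also have "\<dots> = (\<Sum>k<m. \<Sum>i<d. \<Sum>j<d. complex_of_real (p k) * (A $$ (i, j) * ket_bra (v k) $$ (j, i)))"
    by (rule sum.swap)
  also have "\<dots> = (\<Sum>k<m. complex_of_real (p k) * mat_trace (A * ket_bra (v k)))"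
    using v by (intro sum.cong refl) (simp add: mat_trace_mult[OF A'] sum_distrib_left)
  finally have "Re (mat_trace (A * \<rho>)) = (\<Sum>k<m. p k * Re (mat_trace (A * ket_bra (v k))))"
    by simp
  also have "\<dots> = (\<Sum>k<m. p k * expval A (v k))"
    using v by (intro sum.cong refl) (simp add: mat_trace_mult_ket_bra[OF A'])
  finally show ?thesis
    using that pv by blast
qed

lemma ket_bra_separable:
  assumes "product_state ds v"
  shows "ket_bra v \<in> separable_states ds"
proof -
  define d where "d = prod_list ds"
  have u: "unit_state d v" and v: "v \<in> carrier_vec d"
    using assms by (simp_all add: product_state_unit_state unit_state_carrier d_def)
  have "mat_trace (ket_bra v) = v \<bullet>c v"
    using v by (simp add: cscalar_prod_sum[OF v] mat_trace_def ket_bra_def)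
  then have "density_operator d (ket_bra v)"
    using u v by (auto simp: density_operator_def hermitian_ket_bra expval_ket_bra unit_state_def)
  \<comment> \<open>A convex combination with the single weight 1.\<close>
  moreover have "ket_bra v = mat d d (\<lambda>(i, j). \<Sum>k<1::nat. complex_of_real 1 * ket_bra v $$ (i, j))"
    using v by (intro eq_matI) (auto simp: ket_bra_def)
  ultimately show ?thesis
    unfolding separable_states_def mem_Collect_eq d_def using assms
    by (intro conjI exI[of _ "1::nat"] exI[of _ "\<lambda>_. 1"] exI[of _ "\<lambda>_. v"])
      (assumption | simp)+
qed

lemma separable_mat_trace_ge:
  assumes A: "A \<in> carrier_mat (prod_list ds) (prod_list ds)" and \<rho>: "\<rho> \<in> separable_states ds"
    and bound: "\<And>v. product_state ds v \<Longrightarrow> c \<le> expval A v"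
  shows "c \<le> Re (mat_trace (A * \<rho>))"
proof -
  obtain m p v where pv: "\<forall>k<m. 0 \<le> (p k :: real)" "(\<Sum>k<(m::nat). p k) = 1"
    "\<forall>k<m. product_state ds (v k)"
    "Re (mat_trace (A * \<rho>)) = (\<Sum>k<m. p k * expval A (v k))"
    by (rule separable_mat_trace[OF A \<rho>])
  have "c = (\<Sum>k<m. p k * c)"
    using pv(2) by (simp flip: sum_distrib_right)
  also have "\<dots> \<le> (\<Sum>k<m. p k * expval A (v k))"
    by (intro sum_mono mult_left_mono) (use pv bound in auto)
  finally show ?thesis
    by (simp add: pv(4))
qed

text \<open>A minimiser among product vectors is also one among separable states: its projector is
  separable and reaches the lower bound, which is what \<open>LEAST\<close> needs.\<close>

lemma E_sep_eq:
  assumes A: "A \<in> carrier_mat (prod_list ds) (prod_list ds)" and x: "product_state ds x"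
    and min: "\<And>y. product_state ds y \<Longrightarrow> expval A x \<le> expval A y"
  shows "E_sep ds A = expval A x"
  unfolding E_sep_def
proof (rule Least_equality)
  show "\<exists>\<rho>\<in>separable_states ds. expval A x = Re (mat_trace (A * \<rho>))"
    using mat_trace_mult_ket_bra[OF A unit_state_carrier[OF product_state_unit_state[OF x]]]
    by (intro bexI[OF _ ket_bra_separable[OF x]]) simp
next
  fix e assume "\<exists>\<rho>\<in>separable_states ds. e = Re (mat_trace (A * \<rho>))"
  then show "expval A x \<le> e"
    using separable_mat_trace_ge[OF A _ min] by blast
qed

lemma E_sep_le:
  assumes A: "A \<in> carrier_mat (prod_list ds) (prod_list ds)" and d: "prod_list ds \<noteq> 0"
    and v: "product_state ds v"
  shows "E_sep ds A \<le> expval A v"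
proof -
  obtain x where "product_state ds x" "\<And>y. product_state ds y \<Longrightarrow> expval A x \<le> expval A y"
    using product_state_expval_min[OF A d] by blast
  then show ?thesis
    using E_sep_eq[OF A] v by metis
qed

subsection \<open>Geometric entanglement\<close>

lemma M_ent_attained:
  assumes d: "prod_list ds \<noteq> 0" and \<Psi>: "\<Psi> \<in> carrier_vec (prod_list ds)"
  obtains x where "product_state ds x" "M_ent ds \<Psi> = 1 - expval (ket_bra \<Psi>) x"
    "\<And>y. product_state ds y \<Longrightarrow> expval (ket_bra \<Psi>) y \<le> expval (ket_bra \<Psi>) x"
proof -
  \<comment> \<open>The sign turns the search for the largest overlap into a minimisation over
    product vectors.\<close>
  define A where "A = - ket_bra \<Psi>"
  have K: "ket_bra \<Psi> \<in> carrier_mat (prod_list ds) (prod_list ds)"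
    using \<Psi> by simp
  have A: "A \<in> carrier_mat (prod_list ds) (prod_list ds)"
    using K by (simp add: A_def)
  have neg: "expval A y = - expval (ket_bra \<Psi>) y" if "product_state ds y" for y
    unfolding A_def
    by (rule expval_uminus[OF K unit_state_carrier[OF product_state_unit_state[OF that]]])
  obtain x where x: "product_state ds x" "\<And>y. product_state ds y \<Longrightarrow> expval A x \<le> expval A y"
    using product_state_expval_min[OF A d] by blast
  have "(GREATEST z. \<exists>\<rho>\<in>separable_states ds. z = expval \<rho> \<Psi>) = expval (ket_bra \<Psi>) x"
  proof (rule Greatest_equality)
    show "\<exists>\<rho>\<in>separable_states ds. expval (ket_bra \<Psi>) x = expval \<rho> \<Psi>"
      using expval_ket_bra_commute[OF \<Psi> unit_state_carrier[OF product_state_unit_state[OF x(1)]]]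
      by (intro bexI[OF _ ket_bra_separable[OF x(1)]])
  next
    fix z assume "\<exists>\<rho>\<in>separable_states ds. z = expval \<rho> \<Psi>"
    then obtain \<rho> where \<rho>: "\<rho> \<in> separable_states ds" "z = expval \<rho> \<Psi>"
      by blast
    obtain m p v where pv: "\<forall>k<m. 0 \<le> (p k :: real)" "(\<Sum>k<(m::nat). p k) = 1"
      "\<forall>k<m. product_state ds (v k)"
      "Re (mat_trace (ket_bra \<Psi> * \<rho>)) = (\<Sum>k<m. p k * expval (ket_bra \<Psi>) (v k))"
      by (rule separable_mat_trace[OF K \<rho>(1)])
    have "z = (\<Sum>k<m. p k * expval (ket_bra \<Psi>) (v k))"
      using expval_eq_mat_trace[OF separable_states_carrier[OF \<rho>(1)] \<Psi>] \<rho>(2) pv(4) by simp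
    also have "\<dots> \<le> (\<Sum>k<m. p k * expval (ket_bra \<Psi>) x)"
      by (intro sum_mono mult_left_mono) (use pv x neg in auto)
    also have "\<dots> = expval (ket_bra \<Psi>) x"
      using pv(2) by (simp flip: sum_distrib_right)
    finally show "z \<le> expval (ket_bra \<Psi>) x" .
  qed
  then have "M_ent ds \<Psi> = 1 - expval (ket_bra \<Psi>) x"
    by (simp only: M_ent_def)
  then show ?thesis
    using that[OF x(1)] x neg by simp
qed

text \<open>Cauchy-Schwarz for unit vectors: the component of \<open>y\<close> orthogonal to
  \<open>u\<close> has squared length 1 - |<u|y>|^2, which is nonnegative.\<close>

lemma unit_overlap_le_1:
  assumes "unit_state d u" "unit_state d y"
  shows "expval (ket_bra u) y \<le> 1"
proof -
  obtain w where "w \<in> carrier_vec d" "Re (w \<bullet>c w) = 1 - (cmod (y \<bullet>c u))\<^sup>2"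
    by (rule orthogonal_decomposition[OF assms])
  then show ?thesis
    using cscalar_prod_self_nonneg[of w d] assms
    by (simp add: expval_ket_bra[of _ d] unit_state_carrier)
qed

lemma M_ent_nonneg:
  assumes "prod_list ds \<noteq> 0" "unit_state (prod_list ds) \<Psi>"
  shows "0 \<le> M_ent ds \<Psi>"
  using M_ent_attained[OF assms(1) unit_state_carrier[OF assms(2)]]
    unit_overlap_le_1[OF assms(2) product_state_unit_state] by (metis diff_ge_0_iff_ge)

text \<open>
  As an infimum of continuous functions \<open>M_ent ds\<close> is upper semicontinuous, which is
  enough for a maximum; its continuity is not needed.
\<close>

lemma M_ent_attains_max:
  assumes d: "prod_list ds \<noteq> 0"
  obtains \<Psi> where "unit_state (prod_list ds) \<Psi>"
    "\<And>\<Phi>. unit_state (prod_list ds) \<Phi> \<Longrightarrow> M_ent ds \<Phi> \<le> M_ent ds \<Psi>"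
proof -
  let ?d = "prod_list ds"
  have "\<exists>\<Psi>\<in>Collect (unit_state ?d). \<forall>\<Phi>\<in>Collect (unit_state ?d). - M_ent ds \<Psi> \<le> - M_ent ds \<Phi>"
  proof (rule lsc_attains_min)
    show "Collect (unit_state ?d) \<noteq> {}"
      using unit_state_unit_vec[of 0 ?d] d by auto
  next
    fix \<Psi> assume "\<Psi> \<in> Collect (unit_state ?d)"
    then have \<Psi>: "\<Psi> \<in> carrier_vec ?d"
      by (simp add: unit_state_carrier)
    obtain x where x: "product_state ds x" "M_ent ds \<Psi> = 1 - expval (ket_bra \<Psi>) x"
      using M_ent_attained[OF d \<Psi>] by metis
    then have "x \<in> carrier_vec ?d"
      by (simp add: product_state_unit_state unit_state_carrier)
    with x(2) show "- 1 \<le> - M_ent ds \<Psi>"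
      by (simp add: expval_ket_bra[OF \<Psi>])
  next
    fix X :: "nat \<Rightarrow> complex vec" and c
    assume X: "\<And>n. X n \<in> Collect (unit_state ?d)" and c: "(\<lambda>n. - M_ent ds (X n)) \<longlonglongrightarrow> c"
    obtain r \<Psi> where r: "strict_mono r" "unit_state ?d \<Psi>" "vlim ?d (\<lambda>n. X (r n)) \<Psi>"
      using unit_state_vlim_subseq[of ?d X] X by auto
    note \<Psi> = unit_state_carrier[OF r(2)]
    have Xc: "X n \<in> carrier_vec ?d" for n
      using X[of n] by (simp add: unit_state_carrier)
    \<comment> \<open>The product vector nearest to the limit \<Psi> is kept fixed along the
      sequence. For each \<open>X (r n)\<close> it is only a competitor, which bounds
      \<open>M_ent\<close> from above, and its overlap with \<open>X (r n)\<close> converges to that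
      with \<Psi>.\<close>
    obtain x where x: "product_state ds x" "M_ent ds \<Psi> = 1 - expval (ket_bra \<Psi>) x"
      using M_ent_attained[OF d \<Psi>] by metis
    have xc: "x \<in> carrier_vec ?d"
      using x(1) by (simp add: product_state_unit_state unit_state_carrier)
    have "(\<lambda>n. expval (ket_bra x) (X (r n)) - 1) \<longlonglongrightarrow> expval (ket_bra x) \<Psi> - 1"
      using xc Xc \<Psi> r(3) by (intro tendsto_diff tendsto_const tendsto_expval[of _ ?d]) simp_all
    moreover have "expval (ket_bra x) (X (r n)) - 1 \<le> - M_ent ds (X (r n))" for n
    proof -
      obtain y where y: "M_ent ds (X (r n)) = 1 - expval (ket_bra (X (r n))) y"
        "expval (ket_bra (X (r n))) x \<le> expval (ket_bra (X (r n))) y"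
        using M_ent_attained[OF d Xc] x(1) by metis
      then show ?thesis
        by (simp add: expval_ket_bra_commute[OF xc Xc])
    qed
    moreover have "(\<lambda>n. - M_ent ds (X (r n))) \<longlonglongrightarrow> c"
      using LIMSEQ_subseq_LIMSEQ[OF c r(1)] by (simp add: o_def)
    ultimately have "expval (ket_bra x) \<Psi> - 1 \<le> c"
      using LIMSEQ_le by blast
    then have "- M_ent ds \<Psi> \<le> c"
      by (simp add: x(2) expval_ket_bra_commute[OF xc \<Psi>])
    with r(2) show "\<exists>\<Psi>\<in>Collect (unit_state ?d). - M_ent ds \<Psi> \<le> c"
      by auto
  qed
  with that show ?thesis by auto
qed

lemma
  assumes d: "prod_list ds \<noteq> 0"
  shows maximally_entangled_exists: "\<exists>\<Psi>. maximally_entangled ds \<Psi>"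
    and M_ent_le_M_max: "unit_state (prod_list ds) \<Phi> \<Longrightarrow> M_ent ds \<Phi> \<le> M_max ds"
proof -
  obtain \<Psi> where \<Psi>: "unit_state (prod_list ds) \<Psi>"
    "\<And>\<Phi>. unit_state (prod_list ds) \<Phi> \<Longrightarrow> M_ent ds \<Phi> \<le> M_ent ds \<Psi>"
    using M_ent_attains_max[OF d] by metis
  have "M_max ds = M_ent ds \<Psi>"
    unfolding M_max_def by (rule Greatest_equality) (use \<Psi> in auto)
  with \<Psi> show "\<exists>\<Psi>. maximally_entangled ds \<Psi>"
    and "unit_state (prod_list ds) \<Phi> \<Longrightarrow> M_ent ds \<Phi> \<le> M_max ds"
    by (auto simp: maximally_entangled_def)
qed

subsection \<open>The entanglement gap\<close>

text \<open>The bound ranges over all Hermitian \<open>H\<close>, multiples of the identity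
  included: treating \<open>E_tot H = 0\<close> as a case replaces an argument that a Hamiltonian
  has two distinct eigenvalues.\<close>

lemma g_E_le_M_max:
  assumes d: "prod_list ds \<noteq> 0" and H: "hermitian (prod_list ds) H"
  shows "g_E ds H \<le> M_max ds"
proof -
  let ?d = "prod_list ds"
  have Hc: "H \<in> carrier_mat ?d ?d"
    using H by (simp add: hermitian_def)
  obtain u where u: "unit_state ?d u" "H *\<^sub>v u = complex_of_real (E_0 H) \<cdot>\<^sub>v u"
    "expval H u = E_0 H"
    using E_0_variational[OF H d] by metis
  note uc = unit_state_carrier[OF u(1)]
  have "E_0 H \<le> E_max H"
    using E_max_variational[OF H d] uc u by (metis mult.right_neutral one_complex.sel(1) unit_state_def)
  then have tot: "0 \<le> E_tot H"
    by (simp add: E_tot_def)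
  obtain x where x: "product_state ds x" "M_ent ds u = 1 - expval (ket_bra u) x"
    using M_ent_attained[OF d uc] by metis
  have "E_sep ds H \<le> expval H x"
    by (rule E_sep_le[OF Hc d x(1)])
  also have "\<dots> \<le> E_max H - E_tot H * expval (ket_bra u) x"
    by (rule expval_le_ground_overlap[OF H d u(1,2) product_state_unit_state[OF x(1)]])
  finally have "G_E ds H \<le> M_ent ds u * E_tot H"
    by (simp add: G_E_def x(2) E_tot_def algebra_simps)
  then have "g_E ds H \<le> M_ent ds u"
  proof (cases "E_tot H = 0")
    \<comment> \<open>here \<open>g_E ds H = 0\<close> because \<open>x / 0 = 0\<close>\<close>
    case True
    then show ?thesis
      using M_ent_nonneg[OF d u(1)] by (simp add: g_E_def)
  next
    case False
    then show ?thesis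
      using tot \<open>G_E ds H \<le> M_ent ds u * E_tot H\<close> by (simp add: g_E_def pos_divide_le_eq)
  qed
  also have "\<dots> \<le> M_max ds"
    by (rule M_ent_le_M_max[OF d u(1)])
  finally show ?thesis .
qed

text \<open>Dimension at least 2 enters here: two coordinates of a unit vector cannot both have
  modulus 1, so one of the first two basis vectors is not parallel to \<open>u\<close> and has a
  nonzero component orthogonal to it.\<close>

lemma orthogonal_vec_exists:
  assumes d: "2 \<le> d" and u: "unit_state d u"
  obtains w where "w \<in> carrier_vec d" "u \<bullet>c w = 0" "0 < Re (w \<bullet>c w)"
proof -
  have "(\<Sum>i\<in>{0, 1}. (cmod (u $ i))\<^sup>2) \<le> (\<Sum>i<d. (cmod (u $ i))\<^sup>2)"
    by (rule sum_mono2) (use d in auto)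
  then have "(cmod (u $ 0))\<^sup>2 + (cmod (u $ 1))\<^sup>2 \<le> 1"
    using u by (simp add: unit_state_iff)
  then have "(cmod (u $ 0))\<^sup>2 < 1 \<or> (cmod (u $ 1))\<^sup>2 < 1"
    by linarith
  then obtain i where i: "i < d" "(cmod (u $ i))\<^sup>2 < 1"
    using d by (metis Suc_1 Suc_le_lessD less_2_cases_iff order_less_le_trans)
  have uc: "u \<in> carrier_vec d"
    using u by (rule unit_state_carrier)
  have "unit_vec d i \<bullet>c u = cnj (u $ i)"
    using i uc by simp
  then have "(cmod (unit_vec d i \<bullet>c u))\<^sup>2 < 1"
    using i by simp
  then show ?thesis
    using orthogonal_decomposition[OF u unit_state_unit_vec[OF i(1)]] that by (metis diff_gt_0_iff_gt)
qed

section \<open>The Hamiltonian I - |\<Psi>><\<Psi>|\<close>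

context
  fixes ds \<Psi> d H
  assumes dim: "d = prod_list ds" "2 \<le> d" and \<Psi>: "unit_state d \<Psi>"
    and H_def: "H = 1\<^sub>m d - ket_bra \<Psi>"
begin

lemma projector_vec_carrier: "\<Psi> \<in> carrier_vec d"
  using \<Psi> by (rule unit_state_carrier)

lemma hermitian_projector: "hermitian d H"
  unfolding H_def by (intro hermitian_minus hermitian_one hermitian_ket_bra projector_vec_carrier)

lemma expval_projector:
  "x \<in> carrier_vec d \<Longrightarrow> expval H x = Re (x \<bullet>c x) - expval (ket_bra \<Psi>) x"
  unfolding H_def using projector_vec_carrier by (simp add: expval_minus[of _ d] expval_one)

lemma expval_projector_unit: "unit_state d x \<Longrightarrow> expval H x = 1 - expval (ket_bra \<Psi>) x"
  by (simp add: expval_projector unit_state_carrier) (simp add: unit_state_def)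

lemma expval_projector_self: "expval H \<Psi> = 0"
  using \<Psi> by (simp add: expval_projector_unit expval_ket_bra[OF projector_vec_carrier projector_vec_carrier])
    (simp add: unit_state_def)

text \<open>A witness for the eigenvalue 1: it shows both that \<open>H\<close> is not a multiple of
  the identity and that \<open>E_max H\<close> reaches 1.\<close>

lemma projector_orthogonal_vec:
  obtains w where "w \<in> carrier_vec d" "0 < Re (w \<bullet>c w)" "expval H w = Re (w \<bullet>c w)"
proof -
  obtain w where w: "w \<in> carrier_vec d" "\<Psi> \<bullet>c w = 0" "0 < Re (w \<bullet>c w)"
    by (rule orthogonal_vec_exists[OF dim(2) \<Psi>])
  have "expval (ket_bra \<Psi>) w = 0"
    using w cscalar_prod_commute[OF w(1) projector_vec_carrier] by (simp add: expval_ket_bra[OF projector_vec_carrier])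
  with w that show ?thesis
    by (simp add: expval_projector)
qed

lemma hamiltonian_projector: "hamiltonian ds H"
proof -
  have False if c: "H = c \<cdot>\<^sub>m 1\<^sub>m d" for c
  proof -
    have e: "expval H y = Re c * Re (y \<bullet>c y)" if "y \<in> carrier_vec d" for y
      unfolding c by (rule expval_smult_one[OF that])
    \<comment> \<open>The form of \<open>H\<close> vanishes at \<Psi> but is positive at the
      orthogonal witness; a multiple of the identity cannot do both.\<close>
    have "Re c = 0"
      using e[OF projector_vec_carrier] \<Psi> by (simp add: expval_projector_self unit_state_def)
    moreover obtain w where "w \<in> carrier_vec d" "0 < Re (w \<bullet>c w)" "expval H w = Re (w \<bullet>c w)"
      by (rule projector_orthogonal_vec)
    ultimately show False
      using e[of w] by simp
  qed
  with hermitian_projector show ?thesis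
    by (auto simp: hamiltonian_def dim(1))
qed

lemma E_0_projector: "E_0 H = 0"
proof -
  have d0: "d \<noteq> 0" using dim(2) by simp
  obtain u where u: "unit_state d u" "expval H u = E_0 H"
    "\<And>y. y \<in> carrier_vec d \<Longrightarrow> E_0 H * Re (y \<bullet>c y) \<le> expval H y"
    using E_0_variational[OF hermitian_projector d0] by metis
  have "E_0 H \<le> 0"
    using u(3)[OF projector_vec_carrier] \<Psi> by (simp add: expval_projector_self unit_state_def)
  moreover have "0 \<le> E_0 H"
    using expval_projector_unit[OF u(1)] unit_overlap_le_1[OF \<Psi> u(1)] u(2) by simp
  ultimately show ?thesis by simp
qed

lemma E_max_projector: "E_max H = 1"
proof -
  have d0: "d \<noteq> 0" using dim(2) by simp
  obtain u where u: "unit_state d u" "expval H u = E_max H"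
    "\<And>y. y \<in> carrier_vec d \<Longrightarrow> expval H y \<le> E_max H * Re (y \<bullet>c y)"
    using E_max_variational[OF hermitian_projector d0] by metis
  have "E_max H \<le> 1"
    using expval_projector_unit[OF u(1)] u(2)
    by (simp add: expval_ket_bra[OF projector_vec_carrier unit_state_carrier[OF u(1)]])
  moreover obtain w where "w \<in> carrier_vec d" "0 < Re (w \<bullet>c w)" "expval H w = Re (w \<bullet>c w)"
    by (rule projector_orthogonal_vec)
  then have "1 \<le> E_max H"
    using u(3)[of w] by simp
  ultimately show ?thesis by simp
qed

text \<open>On product vectors the energy is 1 minus the overlap with \<Psi>, so the nearest product
  vector also minimises the energy; with extremal eigenvalues 0 and 1 no shift or rescaling
  remains.\<close>

lemma g_E_projector: "g_E ds H = M_ent ds \<Psi>"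
proof -
  have d0: "prod_list ds \<noteq> 0" using dim by linarith
  have Hc: "H \<in> carrier_mat (prod_list ds) (prod_list ds)"
    using hermitian_projector by (simp add: hermitian_def dim(1))
  obtain x where x: "product_state ds x" "M_ent ds \<Psi> = 1 - expval (ket_bra \<Psi>) x"
    "\<And>y. product_state ds y \<Longrightarrow> expval (ket_bra \<Psi>) y \<le> expval (ket_bra \<Psi>) x"
    using M_ent_attained[OF d0 projector_vec_carrier[unfolded dim(1)]] by metis
  have e: "expval H y = 1 - expval (ket_bra \<Psi>) y" if "product_state ds y" for y
    by (rule expval_projector_unit) (simp add: product_state_unit_state[OF that] dim(1))
  have "E_sep ds H = expval H x"
    by (rule E_sep_eq[OF Hc x(1)]) (simp add: e x)
  then show ?thesis
    by (simp add: g_E_def G_E_def E_tot_def E_0_projector E_max_projector e x)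
qed

end

theorem theorem1:
  fixes ds :: "nat list"
  assumes "2 \<le> prod_list ds"
  shows "g_E_max ds = M_max ds
    \<and> (\<forall>H. hamiltonian ds H \<longrightarrow> g_E ds H \<le> g_E_max ds)
    \<and> (\<exists>\<Psi>. maximally_entangled ds \<Psi>)
    \<and> (\<forall>\<Psi>. maximally_entangled ds \<Psi> \<longrightarrow>
          hamiltonian ds (1\<^sub>m (prod_list ds) - ket_bra \<Psi>)
        \<and> g_E ds (1\<^sub>m (prod_list ds) - ket_bra \<Psi>) = g_E_max ds)"
proof -
  have d: "prod_list ds \<noteq> 0"
    using assms by linarith
  have le: "g_E ds H \<le> M_max ds" if "hamiltonian ds H" for H
    using g_E_le_M_max[OF d] that by (simp add: hamiltonian_def)
  have proj: "hamiltonian ds (1\<^sub>m (prod_list ds) - ket_bra \<Psi>)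
      \<and> g_E ds (1\<^sub>m (prod_list ds) - ket_bra \<Psi>) = M_max ds"
    if "maximally_entangled ds \<Psi>" for \<Psi>
    using that hamiltonian_projector[OF refl assms _ refl] g_E_projector[OF refl assms _ refl]
    by (simp add: maximally_entangled_def)
  obtain \<Psi> where \<Psi>: "maximally_entangled ds \<Psi>"
    using maximally_entangled_exists[OF d] by blast
  \<comment> \<open>\<open>GREATEST\<close> is determined because the bound is attained at the
    projector Hamiltonian of a maximally entangled state.\<close>
  have "g_E_max ds = M_max ds"
    unfolding g_E_max_def by (rule Greatest_equality) (use proj[OF \<Psi>] le in force)+
  then show ?thesis
    using le proj \<Psi> by auto
qed

end
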